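(* Let $1<p<\infty$, and let $r_1,r_2\ge 0$ and $s_1,s_2>0$ be real numbers. Let $T_0:\ell_p\to\ell_p$ be the bounded linear operator given, for $x=\{x_n\}_{n\ge1}$ (with $x_{-1}=x_0=0$), by $(T_0x)_n=s_1x_{n-2}+r_1x_n+s_1x_{n+2}$ if $n$ is odd and $(T_0x)_n=s_2x_{n-2}+r_2x_n+s_2x_{n+2}$ if $n$ is even. Then the residual spectrum of $T_0$ over $\ell_p$ is $\sigma_r(T_0,\ell_p)=\emptyset$.
   Context: $\ell_p$ is the complex Banach space of $p$-summable sequences $x=\{x_n\}_{n\ge 1}$. The residual spectrum $\sigma_r(A,X)$ of $A\in B(X)$ is the set of $\lambda\in\mathbb{C}$ for which $A-\lambda I$ is injective but its range $R(A-\lambda I)$ is not dense in $X$. *)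

theory Defs
  imports "HOL-Analysis.Analysis"
begin

section \<open>The space of p-summable sequences\<close>

text \<open>
  A sequence with indices \<open>n \<ge> 1\<close> is a function on \<^typ>\<open>nat\<close> whose value at index 0 is 0. This
  keeps the 1-based parity and builds in the convention \<open>x\<^sub>0 = 0\<close>. The exponent \<open>p\<close> is a
  real parameter, so the space is a carrier set with a norm function rather than a type.
\<close>

definition lp :: "real \<Rightarrow> (nat \<Rightarrow> complex) set" where
  "lp p = {x. x 0 = 0 \<and> summable (\<lambda>n. norm (x n) powr p)}"

definition lp_norm :: "real \<Rightarrow> (nat \<Rightarrow> complex) \<Rightarrow> real" where
  "lp_norm p x = (\<Sum>n. norm (x n) powr p) powr (1 / p)"

definition lp_dist :: "real \<Rightarrow> (nat \<Rightarrow> complex) \<Rightarrow> (nat \<Rightarrow> complex) \<Rightarrow> real" where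
  "lp_dist p x y = lp_norm p (\<lambda>n. x n - y n)"

definition lp_bounded_linear :: "real \<Rightarrow> ((nat \<Rightarrow> complex) \<Rightarrow> (nat \<Rightarrow> complex)) \<Rightarrow> bool" where
  "lp_bounded_linear p A \<longleftrightarrow>
     (\<forall>x\<in>lp p. A x \<in> lp p) \<and>
     (\<forall>x\<in>lp p. \<forall>y\<in>lp p. A (\<lambda>n. x n + y n) = (\<lambda>n. A x n + A y n)) \<and>
     (\<forall>c. \<forall>x\<in>lp p. A (\<lambda>n. c * x n) = (\<lambda>n. c * A x n)) \<and>
     (\<exists>K. \<forall>x\<in>lp p. lp_norm p (A x) \<le> K * lp_norm p x)"

text \<open>The closure is taken in the norm topology of \<^term>\<open>lp p\<close>.\<close>

definition lp_residual_spectrum ::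
  "real \<Rightarrow> ((nat \<Rightarrow> complex) \<Rightarrow> (nat \<Rightarrow> complex)) \<Rightarrow> complex set" where
  "lp_residual_spectrum p A =
     {l. inj_on (\<lambda>x n. A x n - l * x n) (lp p) \<and>
         Metric_space.mtopology (lp p) (lp_dist p)
           closure_of ((\<lambda>x n. A x n - l * x n) ` lp p) \<noteq> lp p}"

text \<open>
  For \<open>n = 1\<close> and \<open>n = 2\<close> the truncated difference \<open>n - 2\<close> is 0, so \<open>x (n - 2)\<close> is
  \<open>x 0 = 0\<close> for \<open>x\<close> in \<^term>\<open>lp p\<close>, which is the value required for \<open>x\<^sub>-\<^sub>1\<close> and \<open>x\<^sub>0\<close>.
\<close>

definition T0 :: "real \<Rightarrow> real \<Rightarrow> real \<Rightarrow> real \<Rightarrow> (nat \<Rightarrow> complex) \<Rightarrow> (nat \<Rightarrow> complex)" where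
  "T0 r1 r2 s1 s2 x n =
     (if n = 0 then 0
      else if odd n
      then of_real s1 * x (n - 2) + of_real r1 * x n + of_real s1 * x (n + 2)
      else of_real s2 * x (n - 2) + of_real r2 * x n + of_real s2 * x (n + 2))"

section \<open>Well-definedness\<close>

lemma lp_norm_nonneg: "0 \<le> lp_norm p x"
  by (simp add: lp_norm_def)

lemma lp_norm_powr:
  assumes "p > 0" "x \<in> lp p"
  shows "lp_norm p x powr p = (\<Sum>n. norm (x n) powr p)"
  using assms by (simp add: lp_norm_def lp_def powr_powr suminf_nonneg)

lemma lp_norm_eq_0_iff:
  assumes "p > 0" "x \<in> lp p"
  shows "lp_norm p x = 0 \<longleftrightarrow> x = (\<lambda>n. 0)"
proof -
  have "lp_norm p x = 0 \<longleftrightarrow> (\<Sum>n. norm (x n) powr p) = 0"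
    using assms by (simp add: lp_norm_def)
  also have "\<dots> \<longleftrightarrow> (\<forall>n. norm (x n) powr p = 0)"
    using assms by (intro suminf_eq_zero_iff) (auto simp: lp_def)
  finally show ?thesis by auto
qed

lemma zero_in_lp: "(\<lambda>n. 0) \<in> lp p"
  by (simp add: lp_def)

lemma scale_in_lp:
  assumes "x \<in> lp p"
  shows "(\<lambda>n. c * x n) \<in> lp p"
  using assms by (simp add: lp_def norm_mult powr_mult summable_mult)

lemma lp_norm_scale:
  assumes "p > 0" "x \<in> lp p"
  shows "lp_norm p (\<lambda>n. c * x n) = norm c * lp_norm p x"
proof -
  have "(\<Sum>n. norm (c * x n) powr p) = norm c powr p * (\<Sum>n. norm (x n) powr p)"
    using assms by (simp add: lp_def norm_mult powr_mult suminf_mult)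
  thus ?thesis
    using assms by (simp add: lp_norm_def lp_def powr_mult powr_powr suminf_nonneg)
qed

lemma powr_convex_ineq:
  fixes p u v x y :: real
  assumes p: "p \<ge> 1" and u: "u \<ge> 0" and v: "v \<ge> 0" and uv: "u + v = 1"
    and x: "x \<ge> 0" and y: "y \<ge> 0"
  shows "(u * x + v * y) powr p \<le> u * x powr p + v * y powr p"
proof -
  have *: "(t * z) powr p \<le> t * z powr p" if "0 \<le> t" "t \<le> 1" for t z :: real
  proof -
    have "t powr p \<le> t"
      using that p powr_mono'[of 1 p t] by (cases "t = 0") auto
    thus ?thesis by (simp add: powr_mult mult_right_mono)
  qed
  consider "x = 0" | "y = 0" | "x > 0" "y > 0"
    using x y by linarith
  thus ?thesis
  proof cases
    case 3
    thus ?thesis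
      using powr_convex[OF p] u v uv unfolding convex_on_def by auto
  qed (use * [of u x] * [of v y] u v uv p in auto)
qed

lemma lp_add_aux:
  assumes p: "p \<ge> 1" and x: "x \<in> lp p" and y: "y \<in> lp p"
    and a: "a > 0" "lp_norm p x \<le> a" and b: "b > 0" "lp_norm p y \<le> b"
  shows "(\<lambda>n. x n + y n) \<in> lp p \<and> lp_norm p (\<lambda>n. x n + y n) \<le> a + b"
proof -
  define f where "f = (\<lambda>n. (a + b) powr p * (a / (a + b) * (norm (x n) powr p / a powr p)
     + b / (a + b) * (norm (y n) powr p / b powr p)))"
  have sx: "summable (\<lambda>n. norm (x n) powr p)" and sy: "summable (\<lambda>n. norm (y n) powr p)"
    using x y by (auto simp: lp_def)
  have le: "norm (x n + y n) powr p \<le> f n" for n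
  proof -
    have "norm (x n + y n) powr p \<le> (norm (x n) + norm (y n)) powr p"
      using p by (intro powr_mono2 norm_triangle_ineq) auto
    also have "norm (x n) + norm (y n)
        = (a + b) * (a / (a + b) * (norm (x n) / a) + b / (a + b) * (norm (y n) / b))"
    proof -
      have "(a + b) * (a / (a + b) * (norm (x n) / a)) = norm (x n)"
        and "(a + b) * (b / (a + b) * (norm (y n) / b)) = norm (y n)"
        using a b by auto
      thus ?thesis by (simp only: distrib_left)
    qed
    also have "\<dots> powr p = (a + b) powr p *
        (a / (a + b) * (norm (x n) / a) + b / (a + b) * (norm (y n) / b)) powr p"
      by (rule powr_mult)
    also have "\<dots> \<le> (a + b) powr p * (a / (a + b) * (norm (x n) / a) powr p
        + b / (a + b) * (norm (y n) / b) powr p)"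
    proof (intro mult_left_mono)
      have w: "a / (a + b) + b / (a + b) = 1"
        using a b by (simp add: add_divide_distrib [symmetric])
      show "(a / (a + b) * (norm (x n) / a) + b / (a + b) * (norm (y n) / b)) powr p
          \<le> a / (a + b) * (norm (x n) / a) powr p + b / (a + b) * (norm (y n) / b) powr p"
        using a b by (intro powr_convex_ineq p w) auto
    qed simp
    finally show ?thesis
      using a b by (simp add: f_def powr_divide)
  qed
  have fs: "f sums ((a + b) powr p * (a / (a + b) * ((\<Sum>n. norm (x n) powr p) / a powr p)
     + b / (a + b) * ((\<Sum>n. norm (y n) powr p) / b powr p)))"
    unfolding f_def
    by (intro sums_mult sums_add sums_divide summable_sums sx sy)
  have S: "summable (\<lambda>n. norm (x n + y n) powr p)"
    using le by (intro summable_comparison_test[OF _ sums_summable[OF fs]]) auto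
  have "(\<Sum>n. norm (x n + y n) powr p) \<le> suminf f"
    using le S sums_summable[OF fs] by (intro suminf_le) auto
  also have "suminf f = (a + b) powr p * (a / (a + b) * (lp_norm p x powr p / a powr p)
     + b / (a + b) * (lp_norm p y powr p / b powr p))"
    using sums_unique[OF fs] p x y by (simp add: lp_norm_powr)
  also have "\<dots> \<le> (a + b) powr p * (a / (a + b) * 1 + b / (a + b) * 1)"
    using a b p
    by (intro mult_left_mono add_mono) (auto simp: divide_le_eq_1 intro!: powr_mono2 lp_norm_nonneg)
  also have "\<dots> = (a + b) powr p"
    using a b by (simp add: add_divide_distrib [symmetric])
  finally have "lp_norm p (\<lambda>n. x n + y n) \<le> ((a + b) powr p) powr (1 / p)"
    unfolding lp_norm_def using p S by (intro powr_mono2 suminf_nonneg) auto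
  also have "\<dots> = a + b"
    using a b p by (simp add: powr_powr)
  finally show ?thesis
    using S x y by (simp add: lp_def)
qed

lemma add_in_lp:
  assumes "p \<ge> 1" "x \<in> lp p" "y \<in> lp p"
  shows "(\<lambda>n. x n + y n) \<in> lp p"
  using lp_add_aux[OF assms, of "lp_norm p x + 1" "lp_norm p y + 1"] lp_norm_nonneg[of p x]
    lp_norm_nonneg[of p y] by auto

lemma lp_norm_triangle:
  assumes "p \<ge> 1" "x \<in> lp p" "y \<in> lp p"
  shows "lp_norm p (\<lambda>n. x n + y n) \<le> lp_norm p x + lp_norm p y"
proof (rule field_le_epsilon)
  fix e :: real assume "e > 0"
  thus "lp_norm p (\<lambda>n. x n + y n) \<le> lp_norm p x + lp_norm p y + e"
    using lp_add_aux[OF assms, of "lp_norm p x + e / 2" "lp_norm p y + e / 2"]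
      lp_norm_nonneg[of p x] lp_norm_nonneg[of p y] by auto
qed

lemma diff_in_lp:
  assumes "p \<ge> 1" "x \<in> lp p" "y \<in> lp p"
  shows "(\<lambda>n. x n - y n) \<in> lp p"
  using add_in_lp[OF assms(1,2) scale_in_lp[OF assms(3), of "-1"]] by simp

lemma Metric_space_lp:
  assumes p: "p \<ge> 1"
  shows "Metric_space (lp p) (lp_dist p)"
proof
  show "0 \<le> lp_dist p x y" for x y
    by (simp add: lp_dist_def lp_norm_nonneg)
  show "lp_dist p x y = lp_dist p y x" for x y
    by (simp add: lp_dist_def lp_norm_def norm_minus_commute)
  show "lp_dist p x y = 0 \<longleftrightarrow> x = y" if "x \<in> lp p" "y \<in> lp p" for x y
    using lp_norm_eq_0_iff[OF _ diff_in_lp[OF p that]] p by (auto simp: lp_dist_def fun_eq_iff)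
  show "lp_dist p x z \<le> lp_dist p x y + lp_dist p y z"
    if "x \<in> lp p" "y \<in> lp p" "z \<in> lp p" for x y z
    using lp_norm_triangle[OF p diff_in_lp[OF p that(1,2)] diff_in_lp[OF p that(2,3)]]
    by (simp add: lp_dist_def)
qed

lemma lp_bounded_linear_T0:
  assumes p: "p \<ge> 1"
  shows "lp_bounded_linear p (T0 r1 r2 s1 s2)"
proof -
  define C where "C = Max {\<bar>r1\<bar>, \<bar>r2\<bar>, \<bar>s1\<bar>, \<bar>s2\<bar>}"
  have C: "\<bar>r1\<bar> \<le> C" "\<bar>r2\<bar> \<le> C" "\<bar>s1\<bar> \<le> C" "\<bar>s2\<bar> \<le> C" "C \<ge> 0"
    unfolding C_def by (auto simp: le_max_iff_disj)
  define K where "K = 3 * C * 3 powr (1 / p)"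
  have main: "T0 r1 r2 s1 s2 x \<in> lp p \<and> lp_norm p (T0 r1 r2 s1 s2 x) \<le> K * lp_norm p x"
    if x: "x \<in> lp p" for x
  proof -
    define f where "f = (\<lambda>n. norm (x n) powr p)"
    have f: "summable f" "\<And>n. f n \<ge> 0" "f 0 = 0"
      using x by (auto simp: f_def lp_def)
    define g where "g = (\<lambda>n. (3 * C) powr p * (f (n - 2) + f n + f (n + 2)))"
    have le: "norm (T0 r1 r2 s1 s2 x n) powr p \<le> g n" for n
    proof (cases "n = 0")
      case True
      thus ?thesis using f(2) by (simp add: T0_def g_def)
    next
      case False
      define m where "m = Max {norm (x (n - 2)), norm (x n), norm (x (n + 2))}"
      have m: "norm (x (n - 2)) \<le> m" "norm (x n) \<le> m" "norm (x (n + 2)) \<le> m"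
        unfolding m_def by auto
      have m': "m \<in> {norm (x (n - 2)), norm (x n), norm (x (n + 2))}"
        unfolding m_def by (intro Max_in) auto
      have m0: "m \<ge> 0" using m(1) norm_ge_zero order_trans by blast
      have tri: "norm (of_real s * x (n - 2) + of_real r * x n + of_real s * x (n + 2)) \<le> 3 * C * m"
        if "\<bar>r\<bar> \<le> C" "\<bar>s\<bar> \<le> C" for r s
      proof -
        have "norm (of_real s * x (n - 2) + of_real r * x n + of_real s * x (n + 2))
            \<le> \<bar>s\<bar> * norm (x (n - 2)) + \<bar>r\<bar> * norm (x n) + \<bar>s\<bar> * norm (x (n + 2))"
          by (intro order_trans[OF norm_triangle_ineq] add_mono) (auto simp: norm_mult)
        also have "\<dots> \<le> C * m + C * m + C * m"
          using that m C(5) by (intro add_mono mult_mono) auto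
        finally show ?thesis by simp
      qed
      have "norm (T0 r1 r2 s1 s2 x n) \<le> 3 * C * m"
        using False C tri[of r1 s1] tri[of r2 s2] by (simp add: T0_def)
      hence "norm (T0 r1 r2 s1 s2 x n) powr p \<le> (3 * C * m) powr p"
        using p by (intro powr_mono2) auto
      also have "\<dots> = (3 * C) powr p * m powr p"
        by (rule powr_mult)
      also have "m powr p \<le> f (n - 2) + f n + f (n + 2)"
        using m' f(2)[of "n - 2"] f(2)[of n] f(2)[of "n + 2"] by (auto simp: f_def)
      finally show ?thesis by (simp add: g_def mult_left_mono)
    qed
    have s1: "(\<lambda>n. f (n - 2)) sums suminf f"
    proof -
      have "(\<lambda>n. f (n + 2 - 2)) sums suminf f"
        using summable_sums[OF f(1)] by simp
      hence "(\<lambda>n. f (n - 2)) sums (suminf f + (\<Sum>i<2. f (i - 2)))"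
        using sums_iff_shift[of "\<lambda>n. f (n - 2)" 2 "suminf f"] by simp
      thus ?thesis using f(3) by (simp add: numeral_2_eq_2)
    qed
    have s2: "(\<lambda>n. f (n + 2)) sums (suminf f - (\<Sum>i<2. f i))"
      using summable_sums[OF f(1)] unfolding sums_iff_shift by simp
    have gs: "g sums ((3 * C) powr p * (suminf f + suminf f + (suminf f - (\<Sum>i<2. f i))))"
      unfolding g_def by (intro sums_mult sums_add s1 s2 summable_sums[OF f(1)])
    have S: "summable (\<lambda>n. norm (T0 r1 r2 s1 s2 x n) powr p)"
      using le by (intro summable_comparison_test[OF _ sums_summable[OF gs]]) auto
    have "(\<Sum>n. norm (T0 r1 r2 s1 s2 x n) powr p) \<le> suminf g"
      using le S sums_summable[OF gs] by (intro suminf_le) auto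
    also have "\<dots> \<le> (3 * C) powr p * (3 * suminf f)"
      unfolding sums_unique[OF gs, symmetric]
      using sum_nonneg[of "{..<2}" f] f(2) by (intro mult_left_mono) auto
    finally have "lp_norm p (T0 r1 r2 s1 s2 x) \<le> ((3 * C) powr p * (3 * suminf f)) powr (1 / p)"
      unfolding lp_norm_def using p S by (intro powr_mono2 suminf_nonneg) auto
    also have "\<dots> = ((3 * C) powr p) powr (1 / p) * (3 powr (1 / p) * suminf f powr (1 / p))"
      using f C(5) by (simp add: powr_mult suminf_nonneg)
    also have "\<dots> = K * lp_norm p x"
      using C(5) p by (simp add: powr_powr K_def lp_norm_def f_def)
    finally show ?thesis
      using S by (simp add: lp_def T0_def)
  qed
  show ?thesis
    unfolding lp_bounded_linear_def using main
    by (auto simp: T0_def fun_eq_iff algebra_simps)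
qed

end

theory Submission
  imports Defs
begin

text \<open>
  The operator splits along the parity of the index into two copies of \<open>s (L + R) + r\<close>, where
  \<open>L\<close> and \<open>R\<close> are the shifts. Write \<open>\<lambda> - r = s (w + 1/w)\<close> with \<open>\<bar>w\<bar> \<le> 1\<close>. For
  \<open>0 < q < 1\<close> the sequence \<open>x\<^sub>k = -(w/s) (q w)\<^sup>k\<close> is in \<open>\<ell>\<^sub>p\<close> and is mapped to the first basis
  vector up to an error of norm \<open>O((1 - q) (1 - q)\<^bsup>-1/p\<^esup>)\<close>, which tends to 0 as \<open>q\<close> tends to 1
  because \<open>p > 1\<close>. Hence the closure of the range contains the first basis vector of either
  parity, by the three-term recurrence all basis vectors, and so everything: the range of
  \<open>T\<^sub>0 - \<lambda>\<close> is dense for every \<open>\<lambda>\<close>.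
\<close>

section \<open>Sequences dominated by geometric ones\<close>

lemma lp_dominated:
  assumes p: "p > 0" and y0: "y 0 = 0"
    and le: "\<And>n. norm (y n) powr p \<le> g n" and g: "summable g"
  shows "y \<in> lp p \<and> lp_norm p y \<le> suminf g powr (1 / p)"
proof -
  have S: "summable (\<lambda>n. norm (y n) powr p)"
    using le by (intro summable_comparison_test[OF _ g]) auto
  have "(\<Sum>n. norm (y n) powr p) \<le> suminf g"
    using le S g by (intro suminf_le) auto
  thus ?thesis
    using S y0 p by (auto simp: lp_def lp_norm_def intro!: powr_mono2 suminf_nonneg)
qed

text \<open>As \<open>p \<ge> 1\<close> gives \<open>t powr p \<le> t\<close>, the
  \<open>p\<close>-th powers sum to at most \<open>c powr p / (1 - t)\<close>. The exponent
  \<open>1 / p\<close> on \<open>1 - t\<close> is decisive later: an error factor of order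
  \<open>1 - t\<close> outweighs it when \<open>p > 1\<close>.\<close>

lemma lp_geometric_bound:
  fixes t c :: real
  assumes p: "p \<ge> 1" and t: "0 < t" "t < 1" and c: "c \<ge> 0" and y0: "y 0 = 0"
    and le: "\<And>n. norm (y n) \<le> c * t ^ n"
  shows "y \<in> lp p" "lp_norm p y \<le> c * (1 - t) powr (- (1 / p))"
proof -
  have tp: "t powr p \<le> t"
    using t p powr_mono'[of 1 p t] by simp
  hence tp1: "norm (t powr p) < 1" using t by simp
  define g where "g = (\<lambda>n. c powr p * (t powr p) ^ n)"
  have g: "g sums (c powr p * (1 / (1 - t powr p)))"
    unfolding g_def by (intro sums_mult geometric_sums tp1)
  have gle: "norm (y n) powr p \<le> g n" for n
  proof -
    have "norm (y n) powr p \<le> (c * t ^ n) powr p"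
      using le[of n] p by (intro powr_mono2) auto
    also have "\<dots> = g n"
      using t by (simp add: g_def powr_mult powr_power powr_realpow[symmetric] powr_powr mult.commute)
    finally show ?thesis .
  qed
  have *: "y \<in> lp p \<and> lp_norm p y \<le> suminf g powr (1 / p)"
    using p y0 gle sums_summable[OF g] by (intro lp_dominated) auto
  thus "y \<in> lp p" by blast
  have "suminf g \<le> c powr p * (1 / (1 - t))"
    unfolding sums_unique[OF g, symmetric] using tp t
    by (intro mult_left_mono divide_left_mono) auto
  hence "suminf g powr (1 / p) \<le> (c powr p * (1 / (1 - t))) powr (1 / p)"
    using p tp t sums_summable[OF g]
    by (intro powr_mono2 suminf_nonneg) (auto simp: g_def)
  also have "\<dots> = c * (1 - t) powr (- (1 / p))"
    using c p t by (simp add: powr_mult powr_powr powr_divide powr_minus field_simps)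
  finally show "lp_norm p y \<le> c * (1 - t) powr (- (1 / p))" using * by simp
qed

section \<open>The closure of the range as a closed subspace\<close>

lemma lp_bounded_linear_diff_scale:
  assumes p: "p \<ge> 1" and A: "lp_bounded_linear p A"
  shows "lp_bounded_linear p (\<lambda>x n. A x n - l * x n)"
proof -
  obtain K where K: "\<forall>x\<in>lp p. lp_norm p (A x) \<le> K * lp_norm p x"
    using A by (auto simp: lp_bounded_linear_def)
  have Ax: "A x \<in> lp p" if "x \<in> lp p" for x
    using A that by (auto simp: lp_bounded_linear_def)
  have "lp_norm p (\<lambda>n. A x n - l * x n) \<le> (K + norm l) * lp_norm p x" if x: "x \<in> lp p" for x
  proof -
    have "lp_norm p (\<lambda>n. A x n + (- l) * x n) \<le> lp_norm p (A x) + lp_norm p (\<lambda>n. (- l) * x n)"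
      by (intro lp_norm_triangle p Ax x scale_in_lp)
    also have "lp_norm p (\<lambda>n. (- l) * x n) = norm l * lp_norm p x"
      using p x by (subst lp_norm_scale) auto
    finally show ?thesis using bspec[OF K x] by (simp add: algebra_simps)
  qed
  hence "\<exists>K. \<forall>x\<in>lp p. lp_norm p (\<lambda>n. A x n - l * x n) \<le> K * lp_norm p x"
    by blast
  thus ?thesis
    using A diff_in_lp[OF p Ax scale_in_lp]
    unfolding lp_bounded_linear_def by (simp add: algebra_simps)
qed

text \<open>An epsilon form of the topological closure, so that the subspace arguments work with
  \<open>lp_norm\<close> alone.\<close>

definition lp_range_closure ::
  "real \<Rightarrow> ((nat \<Rightarrow> complex) \<Rightarrow> (nat \<Rightarrow> complex)) \<Rightarrow> (nat \<Rightarrow> complex) set" where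
  "lp_range_closure p A =
     {y \<in> lp p. \<forall>e>0. \<exists>x\<in>lp p. lp_norm p (\<lambda>n. y n - A x n) < e}"

lemma lp_closure_of_range:
  assumes p: "p \<ge> 1" and A: "lp_bounded_linear p A"
  shows "Metric_space.mtopology (lp p) (lp_dist p) closure_of (A ` lp p) = lp_range_closure p A"
proof -
  interpret Metric_space "lp p" "lp_dist p" by (rule Metric_space_lp[OF p])
  have "A x \<in> lp p" if "x \<in> lp p" for x
    using A that by (auto simp: lp_bounded_linear_def)
  thus ?thesis
    unfolding metric_closure_of lp_range_closure_def by (fastforce simp: lp_dist_def)
qed

lemma range_closure_range:
  assumes "p \<ge> 1" "lp_bounded_linear p A" "x \<in> lp p"
  shows "A x \<in> lp_range_closure p A"
proof -
  have "A x \<in> lp p" using assms by (auto simp: lp_bounded_linear_def)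
  moreover have "lp_norm p (\<lambda>n. A x n - A x n) = 0"
    using assms(1) by (simp add: lp_norm_def)
  ultimately show ?thesis
    using assms(3) by (auto simp: lp_range_closure_def intro!: bexI[of _ x])
qed

lemma range_closure_add:
  assumes p: "p \<ge> 1" and A: "lp_bounded_linear p A"
    and y: "y \<in> lp_range_closure p A" and z: "z \<in> lp_range_closure p A"
  shows "(\<lambda>n. y n + z n) \<in> lp_range_closure p A"
proof -
  have yz: "y \<in> lp p" "z \<in> lp p" using y z by (auto simp: lp_range_closure_def)
  have "\<exists>x\<in>lp p. lp_norm p (\<lambda>n. y n + z n - A x n) < e" if "e > 0" for e
  proof -
    from \<open>e > 0\<close> have e2: "e / 2 > 0" by simp
    obtain u where u: "u \<in> lp p" "lp_norm p (\<lambda>n. y n - A u n) < e / 2"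
      using y e2 unfolding lp_range_closure_def by blast
    obtain v where v: "v \<in> lp p" "lp_norm p (\<lambda>n. z n - A v n) < e / 2"
      using z e2 unfolding lp_range_closure_def by blast
    have Auv: "A u \<in> lp p" "A v \<in> lp p" "A (\<lambda>n. u n + v n) = (\<lambda>n. A u n + A v n)"
      using A u v by (auto simp: lp_bounded_linear_def)
    have "lp_norm p (\<lambda>n. (y n - A u n) + (z n - A v n))
        \<le> lp_norm p (\<lambda>n. y n - A u n) + lp_norm p (\<lambda>n. z n - A v n)"
      using yz Auv by (intro lp_norm_triangle diff_in_lp p)
    hence "lp_norm p (\<lambda>n. y n + z n - A (\<lambda>n. u n + v n) n) < e"
      using u v by (simp add: Auv algebra_simps)
    thus ?thesis using add_in_lp[OF p u(1) v(1)] by blast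
  qed
  thus ?thesis using add_in_lp[OF p yz] by (auto simp: lp_range_closure_def)
qed

lemma range_closure_scale:
  assumes p: "p \<ge> 1" and A: "lp_bounded_linear p A" and y: "y \<in> lp_range_closure p A"
  shows "(\<lambda>n. c * y n) \<in> lp_range_closure p A"
proof -
  have yl: "y \<in> lp p" using y by (auto simp: lp_range_closure_def)
  have "\<exists>x\<in>lp p. lp_norm p (\<lambda>n. c * y n - A x n) < e" if "e > 0" for e
  proof -
    \<comment> \<open>The added 1 keeps the divisor positive when \<open>c = 0\<close>.\<close>
    from \<open>e > 0\<close> have "e / (norm c + 1) > 0" by (simp add: add_nonneg_pos)
    then obtain u where u: "u \<in> lp p" "lp_norm p (\<lambda>n. y n - A u n) < e / (norm c + 1)"
      using y unfolding lp_range_closure_def by blast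
    have Au: "A u \<in> lp p" "A (\<lambda>n. c * u n) = (\<lambda>n. c * A u n)"
      using A u by (auto simp: lp_bounded_linear_def)
    have "lp_norm p (\<lambda>n. c * (y n - A u n)) = norm c * lp_norm p (\<lambda>n. y n - A u n)"
      using p yl Au by (intro lp_norm_scale diff_in_lp) auto
    also have "\<dots> \<le> norm c * (e / (norm c + 1))"
      using u by (intro mult_left_mono) auto
    also have "\<dots> < e"
      using \<open>e > 0\<close> by (simp add: pos_divide_less_eq add_nonneg_pos distrib_left mult.commute)
    finally have "lp_norm p (\<lambda>n. c * y n - A (\<lambda>n. c * u n) n) < e"
      by (simp add: Au algebra_simps)
    thus ?thesis using scale_in_lp[OF u(1)] by blast
  qed
  thus ?thesis using scale_in_lp[OF yl] by (auto simp: lp_range_closure_def)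
qed

lemma range_closure_closed:
  assumes p: "p \<ge> 1" and A: "lp_bounded_linear p A" and y: "y \<in> lp p"
    and approx: "\<And>e. e > 0 \<Longrightarrow> \<exists>z\<in>lp_range_closure p A. lp_norm p (\<lambda>n. y n - z n) < e"
  shows "y \<in> lp_range_closure p A"
proof -
  have "\<exists>x\<in>lp p. lp_norm p (\<lambda>n. y n - A x n) < e" if "e > 0" for e
  proof -
    from \<open>e > 0\<close> have e2: "e / 2 > 0" by simp
    obtain z where z: "z \<in> lp_range_closure p A" "lp_norm p (\<lambda>n. y n - z n) < e / 2"
      using approx[OF e2] by blast
    obtain u where u: "u \<in> lp p" "lp_norm p (\<lambda>n. z n - A u n) < e / 2"
      using z e2 unfolding lp_range_closure_def by blast
    have "z \<in> lp p" "A u \<in> lp p"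
      using z A u by (auto simp: lp_range_closure_def lp_bounded_linear_def)
    hence "lp_norm p (\<lambda>n. (y n - z n) + (z n - A u n))
        \<le> lp_norm p (\<lambda>n. y n - z n) + lp_norm p (\<lambda>n. z n - A u n)"
      using y by (intro lp_norm_triangle diff_in_lp p)
    thus ?thesis using z u by (intro bexI[of _ u]) auto
  qed
  thus ?thesis using y by (auto simp: lp_range_closure_def)
qed

section \<open>Density from the basis vectors\<close>

definition lp_basis :: "nat \<Rightarrow> nat \<Rightarrow> complex" where
  "lp_basis j n = (if n = j then 1 else 0)"

lemma lp_basis_in_lp: "j > 0 \<Longrightarrow> lp_basis j \<in> lp p"
  unfolding lp_def by (auto simp: lp_basis_def intro!: summable_finite[of "{j}"] split: if_splits)

text \<open>Truncations of \<open>y\<close> are finite combinations of basis vectors, and they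
  converge to \<open>y\<close> because the tails of its \<open>p\<close>-sum tend to 0.\<close>

lemma range_closure_eq_lp:
  assumes p: "p \<ge> 1" and A: "lp_bounded_linear p A"
    and basis: "\<And>j. j > 0 \<Longrightarrow> lp_basis j \<in> lp_range_closure p A"
  shows "lp_range_closure p A = lp p"
proof
  show "lp_range_closure p A \<subseteq> lp p" by (auto simp: lp_range_closure_def)
  show "lp p \<subseteq> lp_range_closure p A"
  proof
    fix y assume y: "y \<in> lp p"
    define f where "f = (\<lambda>n. norm (y n) powr p)"
    have f: "summable f" and y0: "y 0 = 0" using y by (auto simp: f_def lp_def)
    have trunc: "(\<lambda>n. if n < N then y n else 0) \<in> lp_range_closure p A" for N
    proof (induction N)
      case 0
      have "(\<lambda>n. 0 * lp_basis 1 n) \<in> lp_range_closure p A"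
        by (intro range_closure_scale p A basis) simp
      thus ?case by simp
    next
      case (Suc N)
      have "(\<lambda>n. if n < Suc N then y n else 0)
          = (\<lambda>n. (if n < N then y n else 0) + y N * lp_basis N n)"
        by (auto simp: fun_eq_iff lp_basis_def less_Suc_eq)
      \<comment> \<open>\<open>lp_basis 0\<close> lies outside \<open>lp p\<close>; for
        \<open>N = 0\<close> the added term vanishes since \<open>y 0 = 0\<close>.\<close>
      thus ?case
        using range_closure_add[OF p A Suc range_closure_scale[OF p A basis, of N "y N"]] y0 Suc
        by (cases "N = 0") auto
    qed
    show "y \<in> lp_range_closure p A"
    proof (rule range_closure_closed[OF p A y])
      fix e :: real assume e: "e > 0"
      hence "e powr p > 0" by simp
      from suminf_exist_split[OF this f] obtain N
        where N: "norm (\<Sum>i. f (i + N)) < e powr p" by auto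
      define z where "z = (\<lambda>n. if n < N then y n else 0)"
      have fN: "summable (\<lambda>i. f (i + N))" using f by (simp add: summable_iff_shift)
      have "lp_norm p (\<lambda>n. y n - z n) = (\<Sum>i. f (i + N)) powr (1 / p)"
      proof -
        have "(\<lambda>i. norm (y (i + N) - z (i + N)) powr p) sums (\<Sum>i. f (i + N))"
          using summable_sums[OF fN] by (simp add: z_def f_def)
        hence "(\<lambda>n. norm (y n - z n) powr p) sums
            ((\<Sum>i. f (i + N)) + (\<Sum>i<N. norm (y i - z i) powr p))"
          using sums_iff_shift[of "\<lambda>n. norm (y n - z n) powr p" N] by simp
        thus ?thesis by (simp add: lp_norm_def sums_iff z_def)
      qed
      also have "\<dots> < (e powr p) powr (1 / p)"
        using N p suminf_nonneg[OF fN] by (intro powr_less_mono2) (auto simp: f_def)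
      finally have "lp_norm p (\<lambda>n. y n - z n) < e" using e p by (simp add: powr_powr)
      thus "\<exists>z\<in>lp_range_closure p A. lp_norm p (\<lambda>n. y n - z n) < e"
        using trunc[of N] by (auto simp: z_def)
    qed
  qed
qed

section \<open>Approximate preimages of the first two basis vectors\<close>

text \<open>The equation is \<open>v * v - m * v + 1 = 0\<close>, whose roots have product 1, so one
  of \<open>v\<close> and \<open>1 / v\<close> lies in the closed unit disc.\<close>

lemma joukowsky_root:
  fixes m :: complex
  obtains w where "w \<noteq> 0" "norm w \<le> 1" "m = w + 1 / w"
proof -
  define v where "v = (m + csqrt (m\<^sup>2 - 4)) / 2"
  have "(2 * v - m)\<^sup>2 = m\<^sup>2 - 4" unfolding v_def by (simp add: field_simps)
  hence "4 * (v * v + 1) = 4 * (m * v)" by (simp add: power2_eq_square algebra_simps)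
  hence eq: "v * v + 1 = m * v" by (simp only: mult_cancel_left) simp
  hence v: "v \<noteq> 0" by auto
  have m: "m = v + 1 / v" using eq v by (simp add: field_simps)
  show thesis
  proof (cases "norm v \<le> 1")
    case True
    thus ?thesis using that[of v] v m by blast
  next
    case False
    thus ?thesis using that[of "1 / v"] v m by (simp add: norm_divide divide_simps)
  qed
qed

text \<open>With \<open>q = 1\<close> the geometric sequence would solve the equation exactly, but
  for \<open>norm w = 1\<close> it is not \<open>p\<close>-summable. Damping by \<open>q < 1\<close>
  restores summability and costs a residual of order \<open>1 - q\<close>.\<close>

lemma T0_first_basis_approx:
  fixes l :: complex
  assumes p: "1 < p" and s: "0 < s1" "0 < s2" and i: "i = 1 \<or> i = 2"
  shows "lp_basis i \<in> lp_range_closure p (\<lambda>x n. T0 r1 r2 s1 s2 x n - l * x n)"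
proof -
  define s r where "s = (if odd i then s1 else s2)" and "r = (if odd i then r1 else r2)"
  have s0: "s > 0" using s by (simp add: s_def)
  obtain w where w: "w \<noteq> 0" "norm w \<le> 1" "(l - of_real r) / of_real s = w + 1 / w"
    by (rule joukowsky_root)
  have l: "l = of_real r + of_real s * (w + 1 / w)"
    using w(3) s0 by (simp add: field_simps)
  have "\<exists>x\<in>lp p. lp_norm p (\<lambda>n. lp_basis i n - (T0 r1 r2 s1 s2 x n - l * x n)) < e"
    if e: "e > 0" for e
  proof -
    \<comment> \<open>The final error is \<open>40 * d powr (1 - 1 / p)\<close>. Here 40 = 5 * 2 *
      4, from the residual, from \<open>1 - q \<le> 2 * d\<close> and from \<open>pow\<close>
      below.\<close>
    have "((\<lambda>d. 40 * d powr (1 - 1 / p)) \<longlongrightarrow> 40 * 0 powr (1 - 1 / p)) (at_right 0)"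
      using p by (intro tendsto_intros) (auto simp: eventually_at_filter)
    hence "\<forall>\<^sub>F d in at_right 0. 40 * d powr (1 - 1 / p) < e"
      using e by (intro order_tendstoD) auto
    \<comment> \<open>\<open>d < 1/2\<close> forces \<open>q > 1/4\<close>, so that dividing by
      \<open>q\<close> costs at most a factor 4.\<close>
    moreover have "\<forall>\<^sub>F d in at_right 0. d \<in> {0<..<1/2::real}"
      by (intro eventually_at_right_real) simp
    ultimately obtain d where d: "0 < d" "d < 1/2" "40 * d powr (1 - 1 / p) < e"
      using eventually_happens[OF eventually_conj] by force
    define t where "t = 1 - d"
    have t: "1/2 < t" "t < 1" using d by (auto simp: t_def)
    define q where "q = t\<^sup>2"
      \<comment> \<open>One step within a parity class is two steps of \<open>n\<close>, so decay \<open>q\<^sup>k\<close> is decay \<open>t\<^sup>n\<close>.\<close>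
    have q: "1/4 < q" "q < 1" "1 - q \<le> 2 * d"
      using t d power_strict_mono[of "1/2" t 2] power_strict_mono[of t 1 2]
      by (auto simp: q_def t_def power2_eq_square algebra_simps)
    \<comment> \<open>For \<open>n = i + 2 * k\<close> with \<open>i\<close> equal to 1 or 2,
      \<open>(n - 1) div 2\<close> is the position \<open>k\<close> within the parity class.\<close>
    define x :: "nat \<Rightarrow> complex" where
      "x = (\<lambda>n. if n > 0 \<and> even (n + i)
                 then - (w / of_real s) * (of_real q * w) ^ ((n - 1) div 2) else 0)"
    have pow: "norm ((of_real q * w) ^ ((n - 1) div 2)) \<le> 4 * t ^ n" if "n > 0" for n
    proof -
      have "norm ((of_real q * w) ^ ((n - 1) div 2)) = q ^ ((n - 1) div 2) * norm w ^ ((n - 1) div 2)"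
        using q by (simp add: norm_power norm_mult power_mult_distrib)
      also have "\<dots> \<le> q ^ ((n - 1) div 2)"
        using w q by (intro mult_right_le_one_le power_le_one) auto
      also have "\<dots> = t ^ (2 * ((n - 1) div 2))" by (simp add: q_def power_mult)
      \<comment> \<open>Raising the exponent by 2 makes it at least \<open>n\<close>, at the price
        of \<open>1 / q < 4\<close>.\<close>
      also have "\<dots> \<le> 4 * t ^ (2 * ((n - 1) div 2) + 2)"
        using q t by (simp add: power_add power2_eq_square q_def)
      also have "\<dots> \<le> 4 * t ^ n"
        using t that by (intro mult_left_mono power_decreasing) auto
      finally show ?thesis .
    qed
    have x_le: "norm (x n) \<le> 4 / s * t ^ n" for n
    proof (cases "n > 0 \<and> even (n + i)")
      case True
      hence "norm (x n) = norm w / s * norm ((of_real q * w) ^ ((n - 1) div 2))"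
        using s0 by (simp add: x_def norm_mult norm_divide)
      also have "\<dots> \<le> 1 / s * (4 * t ^ n)"
        using True w s0 by (intro mult_mono pow divide_right_mono) auto
      finally show ?thesis by simp
    qed (use s0 t in \<open>auto simp: x_def\<close>)
    have x: "x \<in> lp p"
      using p t s0 x_le by (intro lp_geometric_bound(1)[of p t "4 / s"]) (auto simp: x_def)
    define y where "y = (\<lambda>n. lp_basis i n - (T0 r1 r2 s1 s2 x n - l * x n))"
    have y_le: "norm (y n) \<le> (40 * d) * t ^ n" for n
    proof (cases "n > 0 \<and> even (n + i)")
      case False
      \<comment> \<open>\<open>T0\<close> couples only indices of equal parity, and every term is 0
        at index 0.\<close>
      hence "y n = 0"
        using i by (auto simp: y_def T0_def x_def lp_basis_def)
      thus ?thesis using d t by simp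
    next
      case True
      have parity: "odd n = odd i" using True by simp
      have T: "T0 r1 r2 s1 s2 x n - l * x n
          = of_real s * (x (n - 2) + x (n + 2) - (w + 1 / w) * x n)"
        using True parity by (simp add: T0_def l s_def r_def algebra_simps)
      have "norm (y n) \<le> 5 * (1 - q) * norm ((of_real q * w) ^ ((n - 1) div 2))"
      proof (cases "n \<le> 2")
        case n2: True
        hence "n = 1 \<or> n = 2" using True by auto
        hence n: "n = i" using True i by auto
        \<comment> \<open>Here \<open>n - 2 = 0\<close>, so the left neighbour is missing; the
          scaling \<open>- w / s\<close> of \<open>x\<close> makes the remaining terms cancel the
          entry 1 up to a multiple of \<open>1 - q\<close>.\<close>
        have "y n = - (w\<^sup>2 * of_real (1 - q))"
          using n i s0 w(1) unfolding y_def T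
          by (auto simp: x_def lp_basis_def field_simps power2_eq_square)
        moreover have "(n - 1) div 2 = 0" using n i by auto
        ultimately show ?thesis
          using w q mult_mono[of "norm w ^ 2" 1 "1 - q" "5 * (1 - q)"]
          by (simp add: norm_mult norm_power power_le_one del: of_real_diff)
      next
        case n2: False
        define k where "k = (n - 3) div 2"
        have k: "(n - 1) div 2 = Suc k" "(n - 2 - 1) div 2 = k" "(n + 2 - 1) div 2 = Suc (Suc k)"
          using n2 by (auto simp: k_def)
        have "even (n - 2 + i)" using True n2 by simp
        hence xs: "x (n - 2) = - (w / of_real s) * (of_real q * w) ^ k"
          "x n = - (w / of_real s) * (of_real q * w) ^ Suc k"
          "x (n + 2) = - (w / of_real s) * (of_real q * w) ^ Suc (Suc k)"
          using True n2 unfolding x_def k by simp_all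
        have "lp_basis i n = 0" using n2 i by (auto simp: lp_basis_def)
        \<comment> \<open>The recurrence leaves \<open>1 + (q * w)^2 - (w + 1 / w) * q * w\<close>,
          which factors as \<open>(1 - q) * (1 - q * w^2)\<close>.\<close>
        hence "y n = w * (of_real q * w) ^ k * (1 - w\<^sup>2 * of_real q) * of_real (1 - q)"
          using s0 w(1) unfolding y_def unfolding T unfolding xs
          by (simp add: field_simps power2_eq_square)
        \<comment> \<open>Extracting \<open>q\<close> turns the power \<open>k\<close> into
          \<open>Suc k\<close>, the exponent in the claimed bound; the remaining factor is at most
          \<open>1 / q + 1 \<le> 5\<close>.\<close>
        also have "1 - w\<^sup>2 * of_real q = of_real q * (1 / of_real q - w\<^sup>2)"
          using q by (simp add: field_simps)
        finally have y: "y n = (of_real q * w) ^ Suc k * ((1 / of_real q - w\<^sup>2) * of_real (1 - q))"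
          by (simp add: mult_ac)
        have "norm (1 / of_real q - w\<^sup>2) \<le> 1 / q + norm w ^ 2"
          using q by (intro order_trans[OF norm_triangle_ineq4]) (simp add: norm_divide norm_power)
        also have "\<dots> \<le> 4 + 1"
          using q w by (intro add_mono power_le_one) (auto simp: field_simps)
        finally have "norm (1 / of_real q - w\<^sup>2) * norm (of_real (1 - q) :: complex) \<le> 5 * (1 - q)"
          using q by (intro mult_mono) (auto simp del: of_real_diff)
        thus ?thesis unfolding y k
          by (simp only: norm_mult) (metis mult.commute mult_right_mono norm_ge_zero)
      qed
      also have "\<dots> \<le> 5 * (2 * d) * (4 * t ^ n)"
        using True q by (intro mult_mono pow) auto
      finally show ?thesis by simp
    qed
    have "lp_norm p y \<le> (40 * d) * (1 - t) powr (- (1 / p))"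
      using p t d y_le i by (intro lp_geometric_bound(2)) (auto simp: y_def T0_def x_def lp_basis_def)
    also have "\<dots> = 40 * d powr (1 - 1 / p)"
      using d by (simp add: t_def powr_diff powr_minus field_simps)
    also have "\<dots> < e" by (rule d)
    finally show ?thesis using x unfolding y_def by blast
  qed
  thus ?thesis
    using i lp_basis_in_lp[of i p] by (auto simp: lp_range_closure_def)
qed

section \<open>All basis vectors and the residual spectrum\<close>

text \<open>The image of \<open>lp_basis m\<close> involves only the basis vectors
  \<open>m - 2\<close>, \<open>m\<close> and \<open>m + 2\<close>. The last has a nonzero
  coefficient, so the image can be solved for it, and induction in steps of two reaches every
  index.\<close>

theorem T0_range_dense:
  fixes l :: complex
  assumes p: "1 < p" and s: "0 < s1" "0 < s2"
  shows "lp_range_closure p (\<lambda>x n. T0 r1 r2 s1 s2 x n - l * x n) = lp p"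
proof -
  define A where "A = (\<lambda>x n. T0 r1 r2 s1 s2 x n - l * x n)"
  have p1: "p \<ge> 1" using p by simp
  have A: "lp_bounded_linear p A"
    unfolding A_def by (intro lp_bounded_linear_diff_scale lp_bounded_linear_T0 p1)
  have "lp_basis j \<in> lp_range_closure p A" if "j > 0" for j
    using that
  proof (induction j rule: less_induct)
    case (less j)
    show ?case
    proof (cases "j \<le> 2")
      case True
      with less.prems have "j = 1 \<or> j = 2" by auto
      thus ?thesis unfolding A_def by (intro T0_first_basis_approx p s)
    next
      case False
      define m where "m = j - 2"
      have m: "m > 0" "j = m + 2" using False by (auto simp: m_def)
      define \<sigma> \<rho> where "\<sigma> = complex_of_real (if odd m then s1 else s2)"
        and "\<rho> = complex_of_real (if odd m then r1 else r2)"
      have \<sigma>: "\<sigma> \<noteq> 0" using s by (simp add: \<sigma>_def)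
      \<comment> \<open>\<open>u\<close> is the lower neighbour of \<open>lp_basis m\<close>; for
        \<open>m \<le> 2\<close> there is none in \<open>lp p\<close>, and 0 takes its
        place.\<close>
      define u where "u = (\<lambda>n. if m > 2 then lp_basis (m - 2) n else 0)"
      have u: "u \<in> lp_range_closure p A"
        using less.IH[of "m - 2"] range_closure_scale[OF p1 A less.IH[of m], of 0] m
        by (cases "m > 2") (simp_all add: u_def cong: if_cong)
      have "lp_basis j n
          = 1 / \<sigma> * (A (lp_basis m) n + ((l - \<rho>) * lp_basis m n + (- \<sigma>) * u n))" for n
      proof -
        have "A (lp_basis m) n = \<sigma> * lp_basis j n + (\<rho> - l) * lp_basis m n + \<sigma> * u n"
          using m by (auto simp: A_def T0_def \<sigma>_def \<rho>_def lp_basis_def u_def)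
        thus ?thesis using \<sigma> by (simp add: field_simps)
      qed
      hence "lp_basis j
          = (\<lambda>n. 1 / \<sigma> * (A (lp_basis m) n + ((l - \<rho>) * lp_basis m n + (- \<sigma>) * u n)))"
        by blast
      also have "\<dots> \<in> lp_range_closure p A"
        using less.IH[of m] m u
        by (intro range_closure_scale range_closure_add range_closure_range p1 A lp_basis_in_lp) auto
      finally show ?thesis .
    qed
  qed
  thus ?thesis unfolding A_def[symmetric] by (intro range_closure_eq_lp p1 A)
qed

theorem corollary3p5:
  fixes p r1 r2 s1 s2 :: real
  assumes "1 < p"
    and "0 \<le> r1" and "0 \<le> r2"
    and "0 < s1" and "0 < s2"
  shows "lp_residual_spectrum p (T0 r1 r2 s1 s2) = {}"
proof -
  have "Metric_space.mtopology (lp p) (lp_dist p)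
      closure_of ((\<lambda>x n. T0 r1 r2 s1 s2 x n - l * x n) ` lp p) = lp p" for l
    using assms T0_range_dense
    by (subst lp_closure_of_range)
      (auto intro!: lp_bounded_linear_diff_scale lp_bounded_linear_T0)
  thus ?thesis by (simp add: lp_residual_spectrum_def)
qed

end
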